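(* Let $n=2k$ be an even positive integer, and work over a field of characteristic $2$. Then there is an exact sequence of $\mathbb{F}S_n$-modules \[0 \xrightarrow{\hat{\Theta}_{-1}} S^{(n)}_2 \xrightarrow{\hat{\Theta}_0} S^{(n-1,1)}_2 \xrightarrow{\hat{\Theta}_1} \cdots \xrightarrow{\hat{\Theta}_{k-2}} S^{(k+1,k-1)}_2 \xrightarrow{\hat{\Theta}_{k-1}} S^{(k,k)}_2 \xrightarrow{\hat{\Theta}_k} 0.\]
   Context: $\mathbb{F}$ is an arbitrary field of characteristic $2$ and $S_n$ is the symmetric group. For a partition $\lambda$ of $n$, $M^\lambda_2$ is the permutation module over $\mathbb{F}$ with basis the $\lambda$-tabloids, and the Specht module $S^\lambda_2\subseteq M^\lambda_2$ is the submodule spanned by the polytabloids $e_t=\sum_{\sigma\in C_t}\mathrm{sgn}(\sigma)\,\sigma\{t\}$, where $C_t$ is the group of permutations preserving each column of the $\lambda$-tableau $t$. For $0\le i<k$, $\hat\Theta_i: S_2^{(n-i,i)}\to S_2^{(n-i-1,i+1)}$ is the (unique up to scaling) non-zero $\mathbb{F}S_n$-homomorphism; explicitly, it is the restriction to $S_2^{(n-i,i)}$ of the homomorphism $M_2^{(n-i,i)}\to M_2^{(n-i-1,i+1)}$ sending a tabloid $\{s\}$ to the sum of all $(n-i-1,i+1)$-tabloids whose second row contains the second row of $\{s\}$ (the image of this restriction lies in $S_2^{(n-i-1,i+1)}$ because $n$ is even). The maps $\hat\Theta_{-1}$ and $\hat\Theta_k$ are the zero maps. *)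

theory Defs
  imports Complex_Main "HOL-Combinatorics.Permutations" "HOL-Library.Function_Algebras"
begin

section \<open>Tableaux and tabloids\<close>

text \<open>A partition is the list of its parts; rows and columns are numbered from 0, the entries
  of a tableau are 1, ..., n.\<close>

definition diagram :: "nat list \<Rightarrow> (nat \<times> nat) set" where
  "diagram lam = {(r, c). r < length lam \<and> c < lam ! r}"

type_synonym tableau = "nat \<times> nat \<Rightarrow> nat"

text \<open>The values of a tableau outside the diagram are irrelevant and left unconstrained; they
  are identified by row equivalence, so that the tabloids are the usual ones.\<close>

definition tableaux :: "nat list \<Rightarrow> tableau set" where
  "tableaux lam = {t. bij_betw t (diagram lam) {1..sum_list lam}}"

definition row_entries :: "nat list \<Rightarrow> tableau \<Rightarrow> nat \<Rightarrow> nat set" where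
  "row_entries lam t r = {t (r, c) | c. (r, c) \<in> diagram lam}"

definition col_entries :: "nat list \<Rightarrow> tableau \<Rightarrow> nat \<Rightarrow> nat set" where
  "col_entries lam t c = {t (r, c) | r. (r, c) \<in> diagram lam}"

type_synonym tabloid = "tableau set"

definition tabloid_of :: "nat list \<Rightarrow> tableau \<Rightarrow> tabloid" where
  "tabloid_of lam t = {s \<in> tableaux lam. \<forall>r. row_entries lam s r = row_entries lam t r}"

definition tabloids :: "nat list \<Rightarrow> tabloid set" where
  "tabloids lam = tabloid_of lam ` tableaux lam"

text \<open>All members of a tabloid have the same entries in row r.\<close>

definition tabloid_row :: "nat list \<Rightarrow> tabloid \<Rightarrow> nat \<Rightarrow> nat set" where
  "tabloid_row lam T r = (\<Union>s\<in>T. row_entries lam s r)"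

lemma finite_diagram: "finite (diagram lam)"
proof -
  have "diagram lam = (SIGMA r:{..<length lam}. {..<lam ! r})"
    by (auto simp: diagram_def)
  then show ?thesis by simp
qed

lemma finite_tabloids: "finite (tabloids lam)"
proof -
  let ?R = "\<lambda>t. restrict t (diagram lam)"
  have row: "row_entries lam (?R t) = row_entries lam t" for t
    by (rule ext) (auto simp: row_entries_def)
  have "tabloid_of lam t = tabloid_of lam (?R t)" for t
    by (simp add: tabloid_of_def row)
  then have "tabloids lam = tabloid_of lam ` (?R ` tableaux lam)"
    by (auto simp: tabloids_def image_image)
  moreover have "?R ` tableaux lam \<subseteq> diagram lam \<rightarrow>\<^sub>E {1..sum_list lam}"
    by (auto simp: tableaux_def bij_betw_def)
  then have "finite (?R ` tableaux lam)"
    by (rule finite_subset) (simp add: finite_diagram finite_PiE)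
  ultimately show ?thesis by simp
qed

definition tabloid_act :: "(nat \<Rightarrow> nat) \<Rightarrow> tabloid \<Rightarrow> tabloid" where
  "tabloid_act \<sigma> T = (\<lambda>s. \<sigma> \<circ> s) ` T"

lemma tabloid_act_tabloid_of:
  assumes "t \<in> tableaux lam" and p: "\<sigma> permutes {1..sum_list lam}"
  shows "tabloid_act \<sigma> (tabloid_of lam t) = tabloid_of lam (\<sigma> \<circ> t)"
    and "\<sigma> \<circ> t \<in> tableaux lam"
proof -
  have tab: "\<tau> \<circ> s \<in> tableaux lam"
    if "s \<in> tableaux lam" "\<tau> permutes {1..sum_list lam}" for s \<tau>
    using that by (auto simp: tableaux_def intro: bij_betw_trans permutes_imp_bij)
  have row: "row_entries lam (\<tau> \<circ> s) r = \<tau> ` row_entries lam s r" for \<tau> s r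
    by (auto simp: row_entries_def)
  show "\<sigma> \<circ> t \<in> tableaux lam" using tab assms by blast
  have i: "inv \<sigma> \<circ> \<sigma> = id" "\<sigma> \<circ> inv \<sigma> = id"
    using permutes_inv_o[OF p] by auto
  show "tabloid_act \<sigma> (tabloid_of lam t) = tabloid_of lam (\<sigma> \<circ> t)"
  proof
    show "tabloid_act \<sigma> (tabloid_of lam t) \<subseteq> tabloid_of lam (\<sigma> \<circ> t)"
      using tab p by (auto simp: tabloid_act_def tabloid_of_def row)
    show "tabloid_of lam (\<sigma> \<circ> t) \<subseteq> tabloid_act \<sigma> (tabloid_of lam t)"
    proof
      fix s assume s: "s \<in> tabloid_of lam (\<sigma> \<circ> t)"
      have "inv \<sigma> \<circ> s \<in> tabloid_of lam t"
        using s tab[OF _ permutes_inv[OF p]]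
        by (auto simp: tabloid_of_def row image_comp i)
      moreover have "s = \<sigma> \<circ> (inv \<sigma> \<circ> s)" by (simp add: comp_assoc[symmetric] i)
      ultimately show "s \<in> tabloid_act \<sigma> (tabloid_of lam t)"
        unfolding tabloid_act_def by blast
    qed
  qed
qed


section \<open>Permutation modules and Specht modules\<close>

text \<open>Vectors are coefficient functions on tabloids.\<close>

definition scl :: "'a::field \<Rightarrow> (tabloid \<Rightarrow> 'a) \<Rightarrow> (tabloid \<Rightarrow> 'a)" where
  "scl a v = (\<lambda>T. a * v T)"

interpretation tabvec: vector_space "scl :: 'a::field \<Rightarrow> (tabloid \<Rightarrow> 'a) \<Rightarrow> (tabloid \<Rightarrow> 'a)"
  by unfold_locales (auto simp: scl_def fun_eq_iff algebra_simps)

definition basis_vec :: "tabloid \<Rightarrow> (tabloid \<Rightarrow> 'a::field)" where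
  "basis_vec T = (\<lambda>U. if U = T then 1 else 0)"

definition perm_module :: "nat list \<Rightarrow> (tabloid \<Rightarrow> 'a::field) set" where
  "perm_module lam = tabvec.span (basis_vec ` tabloids lam)"

definition perm_act :: "(nat \<Rightarrow> nat) \<Rightarrow> (tabloid \<Rightarrow> 'a::field) \<Rightarrow> (tabloid \<Rightarrow> 'a)" where
  "perm_act \<sigma> v = (\<lambda>T. v (tabloid_act (inv \<sigma>) T))"

lemma perm_act_basis_vec:
  assumes "bij \<sigma>"
  shows "perm_act \<sigma> (basis_vec T :: tabloid \<Rightarrow> 'a::field) = basis_vec (tabloid_act \<sigma> T)"
proof -
  have 1: "inv \<sigma> \<circ> \<sigma> = id" "\<sigma> \<circ> inv \<sigma> = id"
    using assms by (auto simp: bij_is_inj bij_is_surj surj_iff[symmetric])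
  have "tabloid_act (inv \<sigma>) U = T \<longleftrightarrow> U = tabloid_act \<sigma> T" for U
    by (auto simp: tabloid_act_def image_image comp_assoc[symmetric] 1)
  then show ?thesis
    by (simp add: perm_act_def basis_vec_def fun_eq_iff)
qed

definition col_stab :: "nat list \<Rightarrow> tableau \<Rightarrow> (nat \<Rightarrow> nat) set" where
  "col_stab lam t = {\<sigma>. \<sigma> permutes {1..sum_list lam} \<and>
     (\<forall>c. \<sigma> ` col_entries lam t c = col_entries lam t c)}"

definition polytabloid :: "nat list \<Rightarrow> tableau \<Rightarrow> (tabloid \<Rightarrow> 'a::field)" where
  "polytabloid lam t = (\<Sum>\<sigma>\<in>col_stab lam t.
     scl (of_int (sign \<sigma>)) (basis_vec (tabloid_act \<sigma> (tabloid_of lam t))))"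

definition specht :: "nat list \<Rightarrow> (tabloid \<Rightarrow> 'a::field) set" where
  "specht lam = tabvec.span (polytabloid lam ` tableaux lam)"

lemma specht_subset_perm_module: "(specht lam :: (tabloid \<Rightarrow> 'a::field) set) \<subseteq> perm_module lam"
  unfolding specht_def
proof (rule tabvec.span_minimal)
  show "polytabloid lam ` tableaux lam \<subseteq> (perm_module lam :: (tabloid \<Rightarrow> 'a) set)"
  proof (clarify)
    fix t assume "t \<in> tableaux lam"
    then have "basis_vec (tabloid_act \<sigma> (tabloid_of lam t)) \<in> (perm_module lam :: (tabloid \<Rightarrow> 'a) set)"
      if "\<sigma> \<in> col_stab lam t" for \<sigma>
      using that unfolding perm_module_def
      by (auto simp: col_stab_def tabloid_act_tabloid_of tabloids_def intro!: tabvec.span_base)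
    then show "polytabloid lam t \<in> (perm_module lam :: (tabloid \<Rightarrow> 'a) set)"
      unfolding polytabloid_def perm_module_def
      by (intro tabvec.span_sum tabvec.span_scale) auto
  qed
qed (simp add: perm_module_def)


section \<open>Exact sequences of modules for the symmetric group\<close>

text \<open>Modules over the group algebra of the symmetric group on 1, ..., n are treated as vector
  spaces (subspaces of the coefficient functions) with a linear action of the group.\<close>

definition sym_module :: "nat \<Rightarrow> (tabloid \<Rightarrow> 'a::field) set \<Rightarrow> bool" where
  "sym_module n V \<longleftrightarrow> tabvec.subspace V \<and>
     (\<forall>\<sigma>. \<sigma> permutes {1..n} \<longrightarrow> (\<forall>v\<in>V. perm_act \<sigma> v \<in> V))"

definition sym_hom :: "nat \<Rightarrow> (tabloid \<Rightarrow> 'a::field) set \<Rightarrow> (tabloid \<Rightarrow> 'a) set \<Rightarrow>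
    ((tabloid \<Rightarrow> 'a) \<Rightarrow> (tabloid \<Rightarrow> 'a)) \<Rightarrow> bool" where
  "sym_hom n V W f \<longleftrightarrow> (\<forall>v\<in>V. f v \<in> W) \<and>
     (\<forall>u\<in>V. \<forall>v\<in>V. f (u + v) = f u + f v) \<and>
     (\<forall>a. \<forall>v\<in>V. f (scl a v) = scl a (f v)) \<and>
     (\<forall>\<sigma>. \<sigma> permutes {1..n} \<longrightarrow> (\<forall>v\<in>V. f (perm_act \<sigma> v) = perm_act \<sigma> (f v)))"

text \<open>Exactness of the sequence of modules \<open>V a, ..., V b\<close>, where \<open>f i\<close> maps \<open>V i\<close> to \<open>V (i + 1)\<close>.\<close>

definition sym_exact :: "nat \<Rightarrow> int \<Rightarrow> int \<Rightarrow> (int \<Rightarrow> (tabloid \<Rightarrow> 'a::field) set) \<Rightarrow>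
    (int \<Rightarrow> (tabloid \<Rightarrow> 'a) \<Rightarrow> (tabloid \<Rightarrow> 'a)) \<Rightarrow> bool" where
  "sym_exact n a b V f \<longleftrightarrow>
     (\<forall>i\<in>{a..b}. sym_module n (V i)) \<and>
     (\<forall>i\<in>{a..<b}. sym_hom n (V i) (V (i + 1)) (f i)) \<and>
     (\<forall>i\<in>{a<..<b}. f (i - 1) ` V (i - 1) = {v \<in> V i. f i v = 0})"


section \<open>The two-row case\<close>

definition two_row :: "nat \<Rightarrow> nat \<Rightarrow> nat list" where
  "two_row n i = (if i = 0 then [n] else [n - i, i])"

text \<open>The linear map on the permutation module of shape (n-i, i); row 1 is the second row.\<close>

definition theta :: "nat \<Rightarrow> nat \<Rightarrow> (tabloid \<Rightarrow> 'a::field) \<Rightarrow> (tabloid \<Rightarrow> 'a)" where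
  "theta n i v = (\<Sum>S\<in>tabloids (two_row n i). scl (v S)
     (\<Sum>T | T \<in> tabloids (two_row n (i + 1)) \<and>
            tabloid_row (two_row n i) S 1 \<subseteq> tabloid_row (two_row n (i + 1)) T 1.
        basis_vec T))"

lemma theta_basis_vec:
  assumes "S \<in> tabloids (two_row n i)"
  shows "theta n i (basis_vec S :: tabloid \<Rightarrow> 'a::field) =
    (\<Sum>T | T \<in> tabloids (two_row n (i + 1)) \<and>
           tabloid_row (two_row n i) S 1 \<subseteq> tabloid_row (two_row n (i + 1)) T 1.
       basis_vec T)"
proof -
  have *: "scl (basis_vec S U) w = (if U = S then w else 0)" for U and w :: "tabloid \<Rightarrow> 'a"
    by (simp add: basis_vec_def)
  show ?thesis
    unfolding theta_def * using assms by (simp add: finite_tabloids)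
qed

definition theta_hat :: "nat \<Rightarrow> nat \<Rightarrow> int \<Rightarrow> (tabloid \<Rightarrow> 'a::field) \<Rightarrow> (tabloid \<Rightarrow> 'a)" where
  "theta_hat n k i = (if 0 \<le> i \<and> i < int k then theta n (nat i) else (\<lambda>_. 0))"

text \<open>The terms of the sequence, including the zero modules at both ends.\<close>

definition two_row_specht :: "nat \<Rightarrow> nat \<Rightarrow> int \<Rightarrow> (tabloid \<Rightarrow> 'a::field) set" where
  "two_row_specht n k i = (if 0 \<le> i \<and> i \<le> int k then specht (two_row n (nat i)) else {0})"

end

theory Submission
  imports Defs
begin

text \<open>A tabloid of shape \<open>(n - i, i)\<close> is an \<open>i\<close>-subset of \<open>{1..n}\<close>, hence a squarefree monomial
  of degree \<open>i\<close>.  In characteristic 2 the permutation modules form the algebra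
  \<open>F[x\<^sub>1, \<dots>, x\<^sub>n] / (x\<^sub>1\<^sup>2, \<dots>, x\<^sub>n\<^sup>2)\<close>, \<open>\<Theta>\<close> is multiplication by \<open>s = x\<^sub>1 + \<dots> + x\<^sub>n\<close>, and polytabloids are
  products of factors \<open>x\<^sub>a + x\<^sub>b\<close> over disjoint pairs.  The derivative in \<open>x\<^sub>1\<close> maps such a product
  to zero or to the product with one factor removed, so it preserves the Specht modules.  As it is
  a derivation with \<open>\<partial>s = 1\<close>, it is a contracting homotopy: \<open>\<partial>(s f) + s \<partial>f = f\<close>.\<close>

section \<open>Squarefree polynomials in characteristic 2\<close>

definition set_scl :: "'a::field \<Rightarrow> ('b set \<Rightarrow> 'a) \<Rightarrow> 'b set \<Rightarrow> 'a" where
  "set_scl a f = (\<lambda>X. a * f X)"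

interpretation setvec: vector_space "set_scl :: 'a::field \<Rightarrow> ('b set \<Rightarrow> 'a) \<Rightarrow> 'b set \<Rightarrow> 'a"
  by unfold_locales (auto simp: set_scl_def fun_eq_iff algebra_simps)

lemma char2_add_self:
  assumes "CHAR('a::field) = 2"
  shows "x + x = (0::'a)"
  using minus_CHAR_2[OF assms, of x x] by simp

lemma char2_of_int_sign:
  assumes "CHAR('a::field) = 2"
  shows "of_int (sign \<sigma>) = (1::'a)"
  using char2_add_self[OF assms, of 1] by (auto simp: sign_def add_eq_0_iff2)

text \<open>A squarefree polynomial in variables indexed by \<open>'b\<close> is given by its coefficients at the
  finite subsets of \<open>'b\<close>.  Then \<open>raise A\<close> is multiplication by the sum of the
  variables in \<open>A\<close> modulo all squares, and \<open>lower j\<close> is the derivative in the variable \<open>j\<close>.\<close>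

definition raise :: "'b set \<Rightarrow> ('b set \<Rightarrow> 'a::field) \<Rightarrow> 'b set \<Rightarrow> 'a" where
  "raise A f = (\<lambda>X. \<Sum>x\<in>X \<inter> A. f (X - {x}))"

definition lower :: "'b \<Rightarrow> ('b set \<Rightarrow> 'a::field) \<Rightarrow> 'b set \<Rightarrow> 'a" where
  "lower j f = (\<lambda>X. if j \<in> X then 0 else f (insert j X))"

lemma sum_fun_apply:
  fixes f :: "'b \<Rightarrow> 'c \<Rightarrow> 'a::comm_monoid_add"
  shows "(\<Sum>q\<in>S. f q) x = (\<Sum>q\<in>S. f q x)"
  by (induction S rule: infinite_finite_induct) simp_all

text \<open>This is the Leibniz rule for the derivative in \<open>j\<close>, the sum of the
  variables in \<open>A\<close> having derivative 1. If \<open>j\<close> lies in \<open>X\<close>,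
  only the term \<open>x = j\<close> survives. Otherwise that term of
  \<open>lower j (raise A f)\<close> gives \<open>f X\<close>, and the remaining terms cancel
  against \<open>raise A (lower j f) X\<close> in characteristic 2.\<close>

lemma raise_lower:
  fixes f :: "'b set \<Rightarrow> 'a::field"
  assumes "CHAR('a) = 2" and A: "finite A" "j \<in> A"
  shows "raise A (lower j f) + lower j (raise A f) = f"
proof
  fix X :: "'b set"
  show "(raise A (lower j f) + lower j (raise A f)) X = f X"
  proof (cases "j \<in> X")
    case True
    have "raise A (lower j f) X = (\<Sum>x\<in>X \<inter> A. if x = j then f X else 0)"
      unfolding raise_def using True
      by (intro sum.cong) (auto simp: lower_def insert_absorb)
    then show ?thesis
      using True A by (simp add: lower_def)
  next
    case False
    have i: "insert j X \<inter> A = insert j (X \<inter> A)" and j: "insert j X - {j} = X"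
      using A False by auto
    have "lower j (raise A f) X = f X + (\<Sum>x\<in>X \<inter> A. f (insert j X - {x}))"
      using False A by (simp add: lower_def raise_def i j)
    also have "(\<Sum>x\<in>X \<inter> A. f (insert j X - {x})) = raise A (lower j f) X"
      unfolding raise_def using False
      by (intro sum.cong) (auto simp: lower_def insert_Diff_if)
    finally show ?thesis
      using char2_add_self[OF assms(1), of "raise A (lower j f) X"]
      by (simp add: add.left_commute[of _ "f X"])
  qed
qed

lemma raise_add: "raise A (f + g) = raise A f + raise A g"
  by (simp add: raise_def fun_eq_iff sum.distrib)

lemma raise_scl: "raise A (set_scl a f) = set_scl a (raise A f)"
  by (simp add: raise_def set_scl_def fun_eq_iff sum_distrib_left)

lemma lower_add: "lower j (f + g) = lower j f + lower j g"
  by (simp add: lower_def fun_eq_iff)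

lemma lower_scl: "lower j (set_scl a f) = set_scl a (lower j f)"
  by (simp add: lower_def set_scl_def fun_eq_iff)

text \<open>Raising the identity \<open>raise_lower\<close> for \<open>f\<close>, and taking the
  same identity for \<open>raise A f\<close>, gives two expressions for \<open>raise A f\<close>
  with the common term \<open>raise A (lower j (raise A f))\<close>, which drops out.\<close>

lemma lower_raise_raise:
  fixes f :: "'b set \<Rightarrow> 'a::field"
  assumes "CHAR('a) = 2" and "finite A" "j \<in> A"
  shows "lower j (raise A (raise A f)) = raise A (raise A (lower j f))"
proof -
  note h = raise_lower[OF assms]
  have "raise A (raise A (lower j f)) + raise A (lower j (raise A f)) = raise A f"
    unfolding raise_add[symmetric] h ..
  moreover have "raise A (lower j (raise A f)) + lower j (raise A (raise A f)) = raise A f"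
    by (rule h)
  moreover have "- raise A (lower j (raise A f)) = raise A (lower j (raise A f))"
    using char2_add_self[OF assms(1)] by (simp add: fun_eq_iff minus_equation_iff add_eq_0_iff)
  ultimately show ?thesis
    by (metis add.commute add_right_cancel)
qed

text \<open>The square of a sum of variables consists of squares and even multiples of products.
  Induction replaces the double sum: the coefficient at \<open>X\<close> is that of a derivative at
  \<open>X - {j}\<close>, and \<open>lower_raise_raise\<close> moves the derivative onto
  \<open>f\<close>, which is therefore generalized.\<close>

lemma raise_raise:
  fixes f :: "'b set \<Rightarrow> 'a::field"
  assumes "CHAR('a) = 2" and A: "finite A"
  shows "raise A (raise A f) = 0"
proof
  fix X :: "'b set"
  show "raise A (raise A f) X = 0 X"
  proof (induction "card (X \<inter> A)" arbitrary: X f)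
    case 0
    then have "X \<inter> A = {}" using A by simp
    then show ?case by (simp add: raise_def)
  next
    case (Suc m)
    then obtain j where j: "j \<in> X" "j \<in> A"
      by (metis Int_iff card.empty equals0I nat.distinct(1))
    have "raise A (raise A f) X = lower j (raise A (raise A f)) (X - {j})"
      using j by (simp add: lower_def insert_absorb)
    also have "\<dots> = raise A (raise A (lower j f)) (X - {j})"
      using lower_raise_raise[OF assms j(2)] by metis
    also have "\<dots> = 0"
    proof -
      have "(X - {j}) \<inter> A = X \<inter> A - {j}" by auto
      then have "card ((X - {j}) \<inter> A) = m" using Suc.hyps(2) j A by simp
      then show ?thesis using Suc.hyps(1)[of "X - {j}"] by simp
    qed
    finally show ?case by simp
  qed
qed

section \<open>Products of pair sums over matchings\<close>

definition matchings :: "'b set \<Rightarrow> nat \<Rightarrow> 'b set set set" where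
  "matchings A i = {P. \<Union>P \<subseteq> A \<and> pairwise disjnt P \<and> (\<forall>p\<in>P. card p = 2) \<and> card P = i}"

text \<open>The coefficients of the product of the sums \<open>x\<^sub>a + x\<^sub>b\<close> over all pairs \<open>{a, b}\<close> in \<open>P\<close>.\<close>

definition transv :: "'b set set \<Rightarrow> 'b set \<Rightarrow> 'a::field" where
  "transv P X = (if X \<subseteq> \<Union>P \<and> (\<forall>p\<in>P. card (p \<inter> X) = 1) then 1 else 0)"

lemma disjoint_notin_others:
  assumes "pairwise disjnt P" "p \<in> P" "z \<in> p"
  shows "z \<notin> \<Union>(P - {p})"
proof
  assume "z \<in> \<Union>(P - {p})"
  then obtain q where "q \<in> P" "q \<noteq> p" "z \<in> q" by blast
  then show False
    using assms by (meson disjnt_iff pairwiseD)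
qed

lemma matchings_finite:
  assumes "P \<in> matchings A i" "finite A"
  shows "finite P"
  using assms by (auto simp: matchings_def intro: finite_UnionD finite_subset)

text \<open>The left side is the coefficient at \<open>X\<close> of \<open>x_a + x_b\<close> times
  the product over \<open>P\<close>. Both variables are new, so no square arises and the pair
  becomes one more factor.\<close>

lemma sum_pair_transv_new:
  assumes "a \<noteq> b" and "a \<notin> \<Union>P" "b \<notin> \<Union>P"
  shows "(\<Sum>z\<in>{a, b}. if z \<in> X then transv P (X - {z}) else 0)
    = (transv (insert {a, b} P) X :: 'a::field)"
proof -
  have 1: "X - {z} \<subseteq> \<Union>P \<longleftrightarrow> X \<subseteq> insert z (\<Union>P)" for z by auto
  have 2: "p \<inter> (X - {z}) = p \<inter> X" if "p \<in> P" "z \<in> {a, b}" for p z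
    using that assms by auto
  have "transv P (X - {z}) =
      (if X \<subseteq> insert z (\<Union>P) \<and> (\<forall>p\<in>P. card (p \<inter> X) = 1) then 1 else (0::'a))"
    if "z \<in> {a, b}" for z
    using that by (simp add: transv_def 1 2)
  then show ?thesis
    using assms by (auto simp: transv_def)
qed

text \<open>Here the factor is already present. Splitting it off and expanding by
  \<open>sum_pair_transv_new\<close> leaves only the removal of both \<open>a\<close> and
  \<open>b\<close> from \<open>X\<close>, once in each order; the equal terms cancel.\<close>

lemma sum_pair_transv_old:
  fixes P :: "'b set set"
  assumes "CHAR('a::field) = 2"
    and "a \<noteq> b" and P: "{a, b} \<in> P" "pairwise disjnt P"
  shows "(\<Sum>z\<in>{a, b}. if z \<in> X then transv P (X - {z}) else 0) = (0::'a)"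
proof -
  define R where "R = P - {{a, b}}"
  have PR: "P = insert {a, b} R" using P by (auto simp: R_def)
  have ab: "a \<notin> \<Union>R" "b \<notin> \<Union>R"
    using disjoint_notin_others[OF P(2,1)] unfolding R_def by auto
  have e: "transv P Y = (\<Sum>z\<in>{a, b}. if z \<in> Y then transv R (Y - {z}) else (0::'a))" for Y
    unfolding PR sum_pair_transv_new[OF assms(2) ab] ..
  have "X - {b} - {a} = X - {a} - {b}" by blast
  then show ?thesis
    unfolding e using assms(2) char2_add_self[OF assms(1)] by simp
qed

lemma lower_transv_out: "j \<notin> \<Union>P \<Longrightarrow> lower j (transv P) = 0"
  by (auto simp: lower_def transv_def fun_eq_iff)

text \<open>The variable of \<open>j\<close> occurs only in the factor \<open>x_j + x_b\<close> of
  \<open>p\<close>, whose derivative is 1.\<close>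

lemma lower_transv_in:
  assumes P: "pairwise disjnt P" and p: "p \<in> P" "j \<in> p" "card p = 2"
  shows "lower j (transv P) = (transv (P - {p}) :: 'b set \<Rightarrow> 'a::field)"
proof
  fix X
  obtain b where b: "p = {j, b}" "j \<noteq> b"
  proof -
    obtain a c where "p = {a, c}" "a \<noteq> c" using p(3) by (meson card_2_iff)
    then show thesis using p(2) that[of a] that[of c] by (auto simp: insert_commute)
  qed
  define R where "R = P - {p}"
  have PR: "P = insert {j, b} R" using p by (auto simp: R_def b)
  have ab: "j \<notin> \<Union>R" "b \<notin> \<Union>R"
    using disjoint_notin_others[OF P p(1)] b(1) unfolding R_def by auto
  have "lower j (transv P) X = (transv R X :: 'a)"
  proof (cases "j \<in> X")
    case True
    then show ?thesis using ab by (auto simp: lower_def transv_def)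
  next
    case False
    \<comment> \<open>Removing \<open>b\<close> keeps \<open>j\<close>, which lies outside the union
      of \<open>R\<close>. So only the removal of \<open>j\<close> contributes to the expansion over
      the pair.\<close>
    have "b \<in> X \<Longrightarrow> transv R (insert j X - {b}) = (0::'a)"
      using ab b by (auto simp: transv_def)
    moreover have "lower j (transv P) X = (transv (insert {j, b} R) (insert j X) :: 'a)"
      using False by (simp add: lower_def PR)
    ultimately show ?thesis
      unfolding sum_pair_transv_new[OF b(2) ab, symmetric] using False b(2) by simp
  qed
  then show "lower j (transv P) X = (transv (P - {p}) X :: 'a)" by (simp add: R_def)
qed

section \<open>Perfect matchings and multiplication by the sum of all variables\<close>

lemma ex_perfect_matching:
  assumes "finite A" "even (card A)"
  shows "\<exists>Q\<in>matchings A (card A div 2). \<Union>Q = A"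
  using assms
proof (induction "card A" arbitrary: A rule: less_induct)
  case less
  show ?case
  proof (cases "A = {}")
    case True
    then show ?thesis by (auto simp: matchings_def)
  next
    case False
    then have "2 \<le> card A"
      using less.prems by (metis One_nat_def Suc_leI card_gt_0_iff le_antisym not_less_eq_eq numeral_2_eq_2 odd_one)
    then obtain B where B: "B \<subseteq> A" "card B = 2"
      by (meson obtain_subset_with_card_n)
    have fB: "finite B" using B less.prems finite_subset by blast
    have c: "card (A - B) = card A - 2" using B fB by (simp add: card_Diff_subset)
    obtain Q where Q: "Q \<in> matchings (A - B) (card (A - B) div 2)" "\<Union>Q = A - B"
      using less.hyps[of "A - B"] c \<open>2 \<le> card A\<close> less.prems by auto
    have "finite Q" using matchings_finite Q less.prems by blast
    moreover have "B \<notin> Q"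
    proof
      assume "B \<in> Q"
      then have "B \<subseteq> A - B" using Q(2) by blast
      then have "B = {}" by blast
      then show False using B by simp
    qed
    moreover have "\<Union>(insert B Q) = A" using Q(2) B by auto
    ultimately have "insert B Q \<in> matchings A (card A div 2)"
      using Q B c \<open>2 \<le> card A\<close> by (auto simp: matchings_def pairwise_insert disjnt_def)
    then show ?thesis using \<open>\<Union>(insert B Q) = A\<close> by blast
  qed
qed

lemma card_Union_matching:
  assumes "P \<in> matchings A i" "finite A"
  shows "card (\<Union>P) = 2 * i"
proof -
  have "card (\<Union>P) = (\<Sum>p\<in>P. card p)"
    using assms by (intro card_Union_disjoint) (auto simp: matchings_def intro: finite_subset)
  then show ?thesis using assms by (simp add: matchings_def)
qed

text \<open>This is where even cardinality enters: the points missed by \<open>P\<close> are even in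
  number and have a perfect matching of their own. The extension lets the sum of all variables be
  grouped into pairs that include those of \<open>P\<close>.\<close>

lemma ex_perfect_matching_extending:
  assumes P: "P \<in> matchings A i" and A: "finite A" "even (card A)"
  shows "\<exists>Q\<in>matchings A (card A div 2). \<Union>Q = A \<and> P \<subseteq> Q"
proof -
  have sub: "\<Union>P \<subseteq> A" using P by (auto simp: matchings_def)
  have fin: "finite (\<Union>P)" using sub A finite_subset by blast
  have c: "card (A - \<Union>P) = card A - 2 * i"
    using card_Union_matching[OF P A(1)] sub fin by (simp add: card_Diff_subset)
  have le: "2 * i \<le> card A" using card_Union_matching[OF P A(1)] card_mono[OF A(1) sub] by simp
  obtain R where R: "R \<in> matchings (A - \<Union>P) (card (A - \<Union>P) div 2)" "\<Union>R = A - \<Union>P"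
    using ex_perfect_matching[of "A - \<Union>P"] A c by auto
  \<comment> \<open>The unions of \<open>P\<close> and \<open>R\<close> are disjoint, so only the
    empty set could belong to both.\<close>
  have "{} \<notin> P" using P by (auto simp: matchings_def)
  have "P \<inter> R = {}"
  proof (rule ccontr)
    assume "P \<inter> R \<noteq> {}"
    then obtain p where p: "p \<in> P" "p \<in> R" by blast
    then have "p \<subseteq> \<Union>P \<inter> (A - \<Union>P)" using R(2) by blast
    then show False using p \<open>{} \<notin> P\<close> by auto
  qed
  then have "card (P \<union> R) = card A div 2"
    using P R c le matchings_finite[OF P] matchings_finite[OF R(1)] A
    by (simp add: card_Un_disjoint matchings_def)
  moreover have "\<Union>(P \<union> R) = A" using sub R(2) by auto
  moreover have "pairwise disjnt (P \<union> R)"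
    unfolding pairwise_def
  proof (intro ballI impI)
    fix p q assume pq: "p \<in> P \<union> R" "q \<in> P \<union> R" "p \<noteq> q"
    have x: "disjnt p q" if "p \<in> P" "q \<in> R" for p q
      using that R(2) by (auto simp: disjnt_iff)
    show "disjnt p q"
      using pq P R(1) x[of p q] x[of q p]
      unfolding matchings_def by (auto dest: pairwiseD disjnt_sym)
  qed
  ultimately have "P \<union> R \<in> matchings A (card A div 2)"
    using P R(1) by (auto simp: matchings_def)
  then show ?thesis using \<open>\<Union>(P \<union> R) = A\<close> by blast
qed

text \<open>The pairs of \<open>P\<close> contribute nothing because \<open>(x\<^sub>a + x\<^sub>b)\<^sup>2 = 2 x\<^sub>a x\<^sub>b = 0\<close>.\<close>

lemma raise_transv:
  fixes A :: "'b set"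
  assumes c: "CHAR('a::field) = 2" and A: "finite A"
    and Q: "Q \<in> matchings A m" "\<Union>Q = A" and PQ: "P \<subseteq> Q"
  shows "raise A (transv P) = (\<Sum>q\<in>Q - P. (transv (insert q P) :: 'b set \<Rightarrow> 'a))"
proof
  fix X :: "'b set"
  let ?W = "\<lambda>z. if z \<in> X then transv P (X - {z}) else (0::'a)"
  have fQ: "finite Q" using matchings_finite[OF Q(1) A] .
  have Q': "pairwise disjnt Q" "\<And>q. q \<in> Q \<Longrightarrow> card q = 2"
    using Q(1) by (auto simp: matchings_def)
  have pdP: "pairwise disjnt P" using Q'(1) PQ by (rule pairwise_subset)
  have "raise A (transv P) X = (\<Sum>z\<in>A. ?W z)"
    unfolding raise_def using A by (simp add: sum.If_cases Int_commute)
  \<comment> \<open>Since \<open>Q\<close> partitions \<open>A\<close>, the sum of all variables is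
    the sum of the pair sums over \<open>Q\<close>, and each pair can be treated on its own.\<close>
  also have "\<dots> = (\<Sum>q\<in>Q. \<Sum>z\<in>q. ?W z)"
    unfolding Q(2)[symmetric] using Q'
    by (subst sum.Union_disjoint) (auto simp: pairwise_def disjnt_def intro: card_ge_0_finite)
  also have "\<dots> = (\<Sum>q\<in>Q. if q \<in> P then 0 else transv (insert q P) X)"
  proof (rule sum.cong)
    fix q assume q: "q \<in> Q"
    then obtain a b where ab: "q = {a, b}" "a \<noteq> b" using Q'(2) by (meson card_2_iff)
    show "(\<Sum>z\<in>q. ?W z) = (if q \<in> P then 0 else transv (insert q P) X)"
    proof (cases "q \<in> P")
      case True
      then show ?thesis using sum_pair_transv_old[OF c ab(2)] pdP ab(1) by simp
    next
      case False
      have "disjnt q p" if "p \<in> P" for p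
        using pairwiseD[OF Q'(1) q, of p] that PQ False by blast
      then have "a \<notin> \<Union>P" "b \<notin> \<Union>P" by (auto simp: ab(1))
      then show ?thesis using sum_pair_transv_new[OF ab(2)] ab(1) False by simp
    qed
  qed simp
  also have "\<dots> = (\<Sum>q\<in>Q - P. transv (insert q P) X)"
    using fQ by (intro sum.mono_neutral_cong_right) auto
  finally show "raise A (transv P) X = (\<Sum>q\<in>Q - P. (transv (insert q P) :: 'b set \<Rightarrow> 'a)) X"
    by (simp add: sum_fun_apply)
qed

section \<open>The span of the products over matchings\<close>

lemma module_hom_span_subset:
  fixes h :: "('b set \<Rightarrow> 'a::field) \<Rightarrow> ('c set \<Rightarrow> 'a)"
  assumes "\<And>f g. h (f + g) = h f + h g" "\<And>a f. h (set_scl a f) = set_scl a (h f)"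
    and B: "\<And>b. b \<in> B \<Longrightarrow> h b \<in> setvec.span B'"
    and f: "f \<in> setvec.span B"
  shows "h f \<in> setvec.span B'"
proof -
  have "module_hom set_scl set_scl h"
    unfolding module_hom_iff by (intro conjI allI setvec.module_axioms assms(1,2))
  then have "h ` setvec.span B = setvec.span (h ` B)"
    by (rule module_hom.span_image[symmetric])
  also have "\<dots> \<subseteq> setvec.span B'"
    using B by (intro setvec.span_minimal setvec.subspace_span) auto
  finally show ?thesis using f by blast
qed

text \<open>For \<open>A = {1..n}\<close> and \<open>2 * i \<le> n\<close>, in characteristic 2,
  this is the Specht module of shape \<open>(n - i, i)\<close> in polynomial form;
  \<open>specht_two_row\<close> makes the identification.\<close>

definition matching_span :: "'b set \<Rightarrow> nat \<Rightarrow> ('b set \<Rightarrow> 'a::field) set" where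
  "matching_span A i = setvec.span (transv ` matchings A i)"

lemma raise_matching_span:
  fixes f :: "'b set \<Rightarrow> 'a::field"
  assumes c: "CHAR('a) = 2" and A: "finite A" "even (card A)"
    and f: "f \<in> matching_span A i"
  shows "raise A f \<in> matching_span A (Suc i)"
  using f unfolding matching_span_def
proof (rule module_hom_span_subset[rotated -1])
  fix b :: "'b set \<Rightarrow> 'a" assume "b \<in> transv ` matchings A i"
  then obtain P where P: "P \<in> matchings A i" and b: "b = transv P" by blast
  obtain Q where Q: "Q \<in> matchings A (card A div 2)" "\<Union>Q = A" "P \<subseteq> Q"
    using ex_perfect_matching_extending[OF P A] by blast
  have "insert q P \<in> matchings A (Suc i)" if "q \<in> Q - P" for q
  proof -
    have "pairwise disjnt (insert q P)"
      by (rule pairwise_subset[of disjnt Q]) (use Q that in \<open>auto simp: matchings_def\<close>)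
    moreover have "card (insert q P) = Suc i"
      using that P matchings_finite[OF P A(1)] by (simp add: matchings_def)
    moreover have "card q = 2" "q \<subseteq> A" using that Q by (auto simp: matchings_def)
    ultimately show ?thesis using P by (auto simp: matchings_def)
  qed
  then show "raise A b \<in> setvec.span (transv ` matchings A (Suc i))"
    unfolding b raise_transv[OF c A(1) Q]
    by (intro setvec.span_sum setvec.span_base) blast
qed (rule raise_add raise_scl)+

lemma raise_matching_span_top:
  fixes f :: "'b set \<Rightarrow> 'a::field"
  assumes c: "CHAR('a) = 2" and A: "finite A" "card A = 2 * k"
    and f: "f \<in> matching_span A k"
  shows "raise A f = 0"
proof -
  \<comment> \<open>Vanishing is phrased as membership in the span of the empty set, so that it can
    again be checked on generators.\<close>
  have "raise A f \<in> setvec.span {}"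
    using f unfolding matching_span_def
  proof (rule module_hom_span_subset[rotated -1])
    fix b :: "'b set \<Rightarrow> 'a" assume "b \<in> transv ` matchings A k"
    then obtain P where P: "P \<in> matchings A k" and b: "b = transv P" by blast
    have "\<Union>P = A"
      using P A card_Union_matching[OF P A(1)] by (intro card_subset_eq) (auto simp: matchings_def)
    then have "raise A b = 0"
      unfolding b raise_transv[OF c A(1) P \<open>\<Union>P = A\<close> order_refl] by simp
    then show "raise A b \<in> setvec.span {}" by simp
  qed (rule raise_add raise_scl)+
  then show ?thesis by simp
qed

text \<open>This keeps the homotopy of \<open>raise_lower\<close> inside the Specht modules and not
  merely inside the permutation modules.\<close>

lemma lower_matching_span:
  fixes f :: "'b set \<Rightarrow> 'a::field"
  assumes A: "finite A" and f: "f \<in> matching_span A (Suc i)"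
  shows "lower j f \<in> matching_span A i"
  using f unfolding matching_span_def
proof (rule module_hom_span_subset[rotated -1])
  fix b :: "'b set \<Rightarrow> 'a" assume "b \<in> transv ` matchings A (Suc i)"
  then obtain P where P: "P \<in> matchings A (Suc i)" and b: "b = transv P" by blast
  show "lower j b \<in> setvec.span (transv ` matchings A i)"
  proof (cases "j \<in> \<Union>P")
    case True
    then obtain p where p: "p \<in> P" "j \<in> p" by blast
    have P': "pairwise disjnt P" "card p = 2" using P p by (auto simp: matchings_def)
    have "P - {p} \<in> matchings A i"
      using P p pairwise_subset[OF P'(1), of "P - {p}"] matchings_finite[OF P A]
      by (auto simp: matchings_def)
    then show ?thesis
      unfolding b lower_transv_in[OF P'(1) p P'(2)] by (intro setvec.span_base) simp
  qed (simp add: b lower_transv_out setvec.span_zero)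
qed (rule lower_add lower_scl)+

section \<open>Permutations of the variables\<close>

text \<open>Permuting the variables carries the product over \<open>P\<close> to the product over
  the image matching; its coefficient at \<open>X\<close> is the old one at the preimage of
  \<open>X\<close>, whence the inverse.\<close>

lemma image_matching_span:
  assumes \<sigma>: "\<sigma> permutes A" and f: "f \<in> matching_span A i"
  shows "(\<lambda>X. f (inv \<sigma> ` X)) \<in> (matching_span A i :: ('b set \<Rightarrow> 'a::field) set)"
  using f unfolding matching_span_def
proof (rule module_hom_span_subset[rotated -1])
  fix b :: "'b set \<Rightarrow> 'a" assume "b \<in> transv ` matchings A i"
  then obtain P where P: "P \<in> matchings A i" and b: "b = transv P" by blast
  have inj: "inj \<sigma>" using \<sigma> by (rule permutes_inj)
  have inv: "\<sigma> (inv \<sigma> x) = x" "inv \<sigma> (\<sigma> x) = x" for x using \<sigma> permutes_inverses by metis+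
  have sX: "\<sigma> ` inv \<sigma> ` X = X" for X by (simp add: image_image inv)
  have img: "inv \<sigma> ` X \<subseteq> Y \<longleftrightarrow> X \<subseteq> \<sigma> ` Y" for X Y
    using inj_image_subset_iff[OF inj, of "inv \<sigma> ` X" Y] by (simp add: sX)
  have "card (p \<inter> inv \<sigma> ` X) = card (\<sigma> ` p \<inter> X)" for p X
  proof -
    have "\<sigma> ` p \<inter> X = \<sigma> ` (p \<inter> inv \<sigma> ` X)" by (simp add: image_Int[OF inj] sX)
    then show ?thesis using card_image[OF inj_on_subset[OF inj subset_UNIV]] by metis
  qed
  then have "transv P (inv \<sigma> ` X) = (transv ((`) \<sigma> ` P) X :: 'a)" for X
    by (simp add: transv_def img image_Union)
  moreover have "(`) \<sigma> ` P \<in> matchings A i"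
  proof -
    have "\<Union>((`) \<sigma> ` P) \<subseteq> A"
      using P permutes_image[OF \<sigma>] by (auto simp: matchings_def permutes_in_image[OF \<sigma>])
    moreover have "pairwise disjnt ((`) \<sigma> ` P)"
    proof (rule pairwise_imageI)
      fix p q assume "p \<in> P" "q \<in> P" "p \<noteq> q"
      then have "p \<inter> q = {}" using P by (auto simp: matchings_def pairwise_def disjnt_def)
      then show "disjnt (\<sigma> ` p) (\<sigma> ` q)"
        by (simp add: disjnt_def image_Int[OF inj, symmetric])
    qed
    moreover have "card ((`) \<sigma> ` P) = card P"
      using inj by (intro card_image) (auto simp: inj_on_def inj_image_eq_iff)
    moreover have "card (\<sigma> ` p) = card p" for p
      using inj by (intro card_image) (auto simp: inj_on_def)
    ultimately show ?thesis using P by (auto simp: matchings_def)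
  qed
  ultimately show "(\<lambda>X. b (inv \<sigma> ` X)) \<in> setvec.span (transv ` matchings A i)"
    unfolding b by (auto intro: setvec.span_base)
qed (simp_all add: set_scl_def fun_eq_iff)

text \<open>The sum of the variables in \<open>A\<close> is invariant under permutations of
  \<open>A\<close>.\<close>

lemma raise_image:
  assumes \<sigma>: "\<sigma> permutes A"
  shows "raise A (\<lambda>X. f (inv \<sigma> ` X)) = (\<lambda>X. raise A f (inv \<sigma> ` X))"
proof
  fix X
  have inj: "inj (inv \<sigma>)" using \<sigma> by (meson permutes_inj permutes_inv)
  have 1: "inv \<sigma> ` X \<inter> A = inv \<sigma> ` (X \<inter> A)"
    using permutes_in_image[OF permutes_inv[OF \<sigma>]] by auto
  have "inv \<sigma> ` (X - {x}) = inv \<sigma> ` X - {inv \<sigma> x}" for x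
    using inj by (auto simp: inj_def)
  then show "raise A (\<lambda>X. f (inv \<sigma> ` X)) X = raise A f (inv \<sigma> ` X)"
    unfolding raise_def 1 using inj
    by (subst sum.reindex) (auto intro: inj_on_subset)
qed

section \<open>Two-row tabloids and polytabloids\<close>

lemma diagram_two_row: "diagram (two_row n i) = {0} \<times> {..<n - i} \<union> {1} \<times> {..<i}"
  by (auto simp: diagram_def two_row_def nth_Cons less_Suc_eq split: nat.splits if_splits)

lemma sum_list_two_row: "i \<le> n \<Longrightarrow> sum_list (two_row n i) = n"
  by (simp add: two_row_def)

lemma row_entries_two_row:
  "row_entries (two_row n i) t 0 = (\<lambda>c. t (0, c)) ` {..<n - i}"
  "row_entries (two_row n i) t 1 = (\<lambda>c. t (1, c)) ` {..<i}"
  "r \<ge> 2 \<Longrightarrow> row_entries (two_row n i) t r = {}"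
  by (auto simp: row_entries_def diagram_two_row)

lemma col_entries_two_row:
  assumes "2 * i \<le> n"
  shows "col_entries (two_row n i) t c =
    (if c < i then {t (0, c), t (1, c)} else if c < n - i then {t (0, c)} else {})"
  using assms by (auto simp: col_entries_def diagram_two_row)

lemma bij_betw_two_row_tableau:
  assumes "t \<in> tableaux (two_row n i)" "i \<le> n"
  shows "bij_betw t ({0} \<times> {..<n - i} \<union> {1} \<times> {..<i}) {1..n}"
  using assms by (simp add: tableaux_def diagram_two_row sum_list_two_row)

text \<open>The diagram has \<open>n\<close> cells, so surjectivity onto \<open>{1..n}\<close>
  forces injectivity.\<close>

lemma two_row_tableauI:
  assumes i: "i \<le> n" and t: "t ` ({0} \<times> {..<n - i} \<union> {1} \<times> {..<i}) = {1..n}"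
  shows "t \<in> tableaux (two_row n i)"
proof -
  have "card ({0} \<times> {..<n - i} \<union> {1} \<times> {..<i} :: (nat \<times> nat) set) = n"
    using i by (subst card_Un_disjoint) (auto simp: card_cartesian_product)
  then have "inj_on t ({0} \<times> {..<n - i} \<union> {1} \<times> {..<i})"
    by (intro eq_card_imp_inj_on) (simp_all only: t card_atLeastAtMost, auto)
  then show ?thesis
    using t i by (simp add: tableaux_def diagram_two_row sum_list_two_row bij_betw_def)
qed

lemma row_entries_two_row_partition:
  assumes t: "t \<in> tableaux (two_row n i)" "i \<le> n"
  shows "row_entries (two_row n i) t 1 \<subseteq> {1..n}"
    and "card (row_entries (two_row n i) t 1) = i"
    and "row_entries (two_row n i) t 0 = {1..n} - row_entries (two_row n i) t 1"
proof -
  note b = bij_betw_two_row_tableau[OF t]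
  have r: "row_entries (two_row n i) t 1 = t ` ({1} \<times> {..<i})"
    "row_entries (two_row n i) t 0 = t ` ({0} \<times> {..<n - i})"
    unfolding row_entries_two_row by auto
  show "row_entries (two_row n i) t 1 \<subseteq> {1..n}"
    unfolding r using b by (auto simp: bij_betw_def)
  have "inj_on t ({1} \<times> {..<i})"
    using b by (auto simp: bij_betw_def intro: inj_on_subset)
  then show "card (row_entries (two_row n i) t 1) = i"
    unfolding r by (simp add: card_image card_cartesian_product)
  have "t ` ({0} \<times> {..<n - i}) \<inter> t ` ({1} \<times> {..<i}) = {}"
    using b by (auto simp: bij_betw_def inj_on_def)
  moreover have "t ` ({0} \<times> {..<n - i}) \<union> t ` ({1} \<times> {..<i}) = {1..n}"
    using b by (simp add: bij_betw_def image_Un)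
  ultimately show "row_entries (two_row n i) t 0 = {1..n} - row_entries (two_row n i) t 1"
    unfolding r by blast
qed

section \<open>Two-row tabloids as subsets\<close>

lemma tabloid_row_tabloid_of:
  assumes "t \<in> tableaux lam"
  shows "tabloid_row lam (tabloid_of lam t) r = row_entries lam t r"
  using assms by (auto simp: tabloid_row_def tabloid_of_def)

lemma ex_two_row_tableau:
  assumes "X \<subseteq> {1..n}" "card X = i"
  shows "\<exists>t\<in>tableaux (two_row n i). row_entries (two_row n i) t 1 = X"
proof -
  have fX: "finite X" using assms(1) finite_subset by blast
  have i: "i \<le> n" using card_mono[OF _ assms(1)] assms(2) by simp
  obtain f where f: "bij_betw f {..<i} X"
    using ex_bij_betw_nat_finite[OF fX] assms(2) by (auto simp: atLeast0LessThan)
  have "card ({1..n} - X) = n - i" using assms fX by (simp add: card_Diff_subset)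
  then obtain g where g: "bij_betw g {..<n - i} ({1..n} - X)"
    using ex_bij_betw_nat_finite[of "{1..n} - X"] by (auto simp: atLeast0LessThan)
  define t :: tableau where "t = (\<lambda>(r, c). if r = 0 then g c else f c)"
  have "t ` ({0} \<times> {..<n - i} \<union> {1} \<times> {..<i}) = g ` {..<n - i} \<union> f ` {..<i}"
    by (force simp: t_def image_iff)
  also have "\<dots> = {1..n}" using f g assms by (auto simp: bij_betw_def)
  finally have "t \<in> tableaux (two_row n i)" by (rule two_row_tableauI[OF i])
  moreover have "row_entries (two_row n i) t 1 = X"
    unfolding row_entries_two_row using f by (simp add: t_def bij_betw_def)
  ultimately show ?thesis by blast
qed

text \<open>The first row is the complement of the second, so the second row determines the tabloid.
  For \<open>i = 0\<close> the shape has a single row, and row 1 is the empty set.\<close>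

lemma bij_betw_tabloid_row:
  assumes i: "i \<le> n"
  shows "bij_betw (\<lambda>T. tabloid_row (two_row n i) T 1) (tabloids (two_row n i))
    {X. X \<subseteq> {1..n} \<and> card X = i}"
proof (rule bij_betw_imageI)
  let ?lam = "two_row n i"
  show "inj_on (\<lambda>T. tabloid_row ?lam T 1) (tabloids ?lam)"
  proof (rule inj_onI)
    fix S T assume "S \<in> tabloids ?lam" "T \<in> tabloids ?lam"
      and e: "tabloid_row ?lam S 1 = tabloid_row ?lam T 1"
    then obtain s t where s: "s \<in> tableaux ?lam" "S = tabloid_of ?lam s"
      and t: "t \<in> tableaux ?lam" "T = tabloid_of ?lam t"
      by (auto simp: tabloids_def)
    have 1: "row_entries ?lam s 1 = row_entries ?lam t 1"
      using e s t by (simp add: tabloid_row_tabloid_of)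
    have "row_entries ?lam s r = row_entries ?lam t r" for r
    proof -
      consider "r = 0" | "r = 1" | "r \<ge> 2" by linarith
      then show ?thesis
        using 1 row_entries_two_row_partition(3)[OF s(1) i] row_entries_two_row_partition(3)[OF t(1) i]
        by cases (simp_all add: row_entries_two_row(3))
    qed
    then show "S = T" using s t by (simp add: tabloid_of_def)
  qed
  show "(\<lambda>T. tabloid_row ?lam T 1) ` tabloids ?lam = {X. X \<subseteq> {1..n} \<and> card X = i}"
  proof (intro equalityI subsetI)
    fix X assume "X \<in> (\<lambda>T. tabloid_row ?lam T 1) ` tabloids ?lam"
    then obtain t where t: "t \<in> tableaux ?lam" "X = row_entries ?lam t 1"
      by (auto simp: tabloids_def tabloid_row_tabloid_of)
    then show "X \<in> {X. X \<subseteq> {1..n} \<and> card X = i}"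
      using row_entries_two_row_partition(1,2)[OF t(1) i] by simp
  next
    fix X assume "X \<in> {X. X \<subseteq> {1..n} \<and> card X = i}"
    then obtain t where t: "t \<in> tableaux ?lam" "X = row_entries ?lam t 1"
      using ex_two_row_tableau[of X n i] by blast
    then have "X = tabloid_row ?lam (tabloid_of ?lam t) 1" by (simp add: tabloid_row_tabloid_of)
    then show "X \<in> (\<lambda>T. tabloid_row ?lam T 1) ` tabloids ?lam"
      using t(1) by (auto simp: tabloids_def)
  qed
qed

section \<open>Vectors on tabloids as squarefree polynomials\<close>

text \<open>This reads off the homogeneous component of degree \<open>i\<close>: values of
  \<open>g\<close> at sets other than the \<open>i\<close>-subsets of \<open>{1..n}\<close> are
  lost. Equality of images therefore gives equality of functions only at those subsets.\<close>

definition tabloid_vec :: "nat \<Rightarrow> nat \<Rightarrow> (nat set \<Rightarrow> 'a::field) \<Rightarrow> tabloid \<Rightarrow> 'a" where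
  "tabloid_vec n i g =
    (\<lambda>T. if T \<in> tabloids (two_row n i) then g (tabloid_row (two_row n i) T 1) else 0)"

lemma tabloid_vec_cong:
  assumes "i \<le> n" and "\<And>X. X \<subseteq> {1..n} \<Longrightarrow> card X = i \<Longrightarrow> f X = g X"
  shows "tabloid_vec n i f = tabloid_vec n i g"
  using bij_betwE[OF bij_betw_tabloid_row[OF assms(1)]] assms(2)
  by (auto simp: tabloid_vec_def fun_eq_iff)

lemma tabloid_vec_eq_0:
  assumes "i \<le> n" and 0: "tabloid_vec n i f = 0" and X: "X \<subseteq> {1..n}" "card X = i"
  shows "f X = 0"
proof -
  have "X \<in> (\<lambda>T. tabloid_row (two_row n i) T 1) ` tabloids (two_row n i)"
    using bij_betw_imp_surj_on[OF bij_betw_tabloid_row[OF assms(1)]] X by simp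
  then obtain T where "T \<in> tabloids (two_row n i)" "X = tabloid_row (two_row n i) T 1" by blast
  then show ?thesis using fun_cong[OF 0, of T] by (simp add: tabloid_vec_def)
qed

lemma tabloid_vec_0: "tabloid_vec n i 0 = 0"
  by (simp add: tabloid_vec_def fun_eq_iff)

text \<open>The coefficient at \<open>T\<close> collects the tabloids whose second row lies in the
  second row \<open>X\<close> of \<open>T\<close>. As \<open>X\<close> has \<open>i + 1\<close>
  elements, these second rows are exactly the sets \<open>X - {x}\<close>, as in
  \<open>raise\<close>.\<close>

lemma theta_tabloid_vec:
  assumes i: "i < n"
  shows "theta n i (tabloid_vec n i g) = tabloid_vec n (Suc i) (raise {1..n} g)"
proof
  fix T
  let ?S = "tabloids (two_row n i)" and ?S' = "tabloids (two_row n (Suc i))"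
  let ?r = "\<lambda>T. tabloid_row (two_row n i) T 1" and ?r' = "\<lambda>T. tabloid_row (two_row n (Suc i)) T 1"
  have basis: "(\<Sum>T' | T' \<in> ?S' \<and> ?r S \<subseteq> ?r' T'. basis_vec T') T
      = (if T \<in> ?S' \<and> ?r S \<subseteq> ?r' T then 1 else (0::'a))" for S
    using finite_tabloids[of "two_row n (Suc i)"]
    by (simp add: sum_fun_apply basis_vec_def)
  have "theta n i (tabloid_vec n i g) T = (\<Sum>S\<in>?S. tabloid_vec n i g S *
      (\<Sum>T' | T' \<in> ?S' \<and> ?r S \<subseteq> ?r' T'. basis_vec T') T)"
    unfolding theta_def by (subst sum_fun_apply) (simp add: scl_def)
  also have "\<dots> = (\<Sum>S\<in>?S. if T \<in> ?S' \<and> ?r S \<subseteq> ?r' T then g (?r S) else 0)"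
    unfolding basis by (intro sum.cong) (simp_all add: tabloid_vec_def)

  also have "\<dots> = tabloid_vec n (Suc i) (raise {1..n} g) T"
  proof (cases "T \<in> ?S'")
    case True
    define X where "X = ?r' T"
    have X: "X \<subseteq> {1..n}" "card X = Suc i"
      using bij_betwE[OF bij_betw_tabloid_row[of "Suc i" n]] True i by (auto simp: X_def)
    have fX: "finite X" using X finite_subset by blast
    have "(\<Sum>S\<in>?S. if T \<in> ?S' \<and> ?r S \<subseteq> ?r' T then g (?r S) else 0)
        = (\<Sum>Y | Y \<subseteq> {1..n} \<and> card Y = i. if Y \<subseteq> X then g Y else 0)"
      using True by (subst sum.reindex_bij_betw[OF bij_betw_tabloid_row[of i n], symmetric])
        (use i in \<open>simp_all add: X_def\<close>)
    also have "\<dots> = (\<Sum>Y | Y \<subseteq> X \<and> card Y = i. g Y)"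
      using X by (intro sum.mono_neutral_cong_right) (auto intro: finite_subset[of _ "Pow {1..n}"])
    also have "\<dots> = (\<Sum>x\<in>X. g (X - {x}))"
    proof (rule sum.reindex_bij_betw[symmetric])
      have "inj_on (\<lambda>x. X - {x}) X" by (auto simp: inj_on_def)
      moreover have "Y \<in> (\<lambda>x. X - {x}) ` X" if "Y \<subseteq> X" "card Y = i" for Y
      proof -
        have "card (X - Y) = 1"
          using that X fX by (simp add: card_Diff_subset finite_subset[OF that(1)])
        then obtain x where "X - Y = {x}" by (auto simp: card_1_singleton_iff)
        then have "x \<in> X" "Y = X - {x}" using that(1) by auto
        then show ?thesis by blast
      qed
      ultimately show "bij_betw (\<lambda>x. X - {x}) X {Y. Y \<subseteq> X \<and> card Y = i}"
        using X fX by (auto simp: bij_betw_def)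
    qed
    also have "\<dots> = raise {1..n} g X"
      using X by (simp add: raise_def Int_absorb2)
    finally show ?thesis using True by (simp add: tabloid_vec_def X_def)
  qed (simp add: tabloid_vec_def)
  finally show "theta n i (tabloid_vec n i g) T = tabloid_vec n (Suc i) (raise {1..n} g) T" .
qed

text \<open>A column permutation is determined by the set it maps the second row to, and these sets are
  the transversals of the columns of length 2.\<close>

lemma card_col_stab_row_image:
  fixes n i :: nat and t :: tableau
  defines "C \<equiv> col_stab (two_row n i) t"
    and "B \<equiv> row_entries (two_row n i) t 1"
    and "P \<equiv> (\<lambda>c. {t (0, c), t (1, c)}) ` {..<i}"
  assumes t: "t \<in> tableaux (two_row n i)" and i: "2 * i \<le> n"
  shows "of_nat (card {\<sigma>\<in>C. \<sigma> ` B = X}) = (transv P X :: 'a::field)"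
proof -
  have "i \<le> n" using i by simp
  let ?D = "{0} \<times> {..<n - i} \<union> {1} \<times> {..<i} :: (nat \<times> nat) set"
  have bij: "bij_betw t ?D {1..n}" using bij_betw_two_row_tableau[OF t \<open>i \<le> n\<close>] .
  then have inj: "inj_on t ?D" by (simp add: bij_betw_def)
  have eq: "t d = t e \<longleftrightarrow> d = e" if "d \<in> ?D" "e \<in> ?D" for d e
    using inj that by (simp add: inj_on_eq_iff)
  have C: "\<sigma> permutes {1..n}" "\<And>c. c < i \<Longrightarrow> \<sigma> ` {t (0, c), t (1, c)} = {t (0, c), t (1, c)}"
    "\<And>c. i \<le> c \<Longrightarrow> c < n - i \<Longrightarrow> \<sigma> (t (0, c)) = t (0, c)" if "\<sigma> \<in> C" for \<sigma>
  proof -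
    have p: "\<sigma> permutes {1..n}"
      and *: "\<sigma> ` col_entries (two_row n i) t c = col_entries (two_row n i) t c" for c
      using that \<open>i \<le> n\<close> by (auto simp: C_def col_stab_def sum_list_two_row)
    show "\<sigma> permutes {1..n}" by (rule p)
    show "\<sigma> ` {t (0, c), t (1, c)} = {t (0, c), t (1, c)}" if "c < i" for c
      using *[of c] that by (simp only: col_entries_two_row[OF i] if_True)
    show "\<sigma> (t (0, c)) = t (0, c)" if "i \<le> c" "c < n - i" for c
      using *[of c] that by (simp add: col_entries_two_row[OF i])
  qed
  have B: "B = (\<lambda>c. t (1, c)) ` {..<i}" by (simp only: B_def row_entries_two_row)
  have pair_B: "{t (0, c), t (1, c)} \<inter> B = {t (1, c)}" if "c < i" for c
    using that i by (auto simp: B eq)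
  \<comment> \<open>A column permutation preserves each column of length 2, so the image of the
    second row meets that column exactly in the image of its lower entry.\<close>
  have pair_X: "{t (0, c), t (1, c)} \<inter> \<sigma> ` B = {\<sigma> (t (1, c))}" if "\<sigma> \<in> C" "c < i" for \<sigma> c
  proof -
    have "\<sigma> ` ({t (0, c), t (1, c)} \<inter> B) = \<sigma> ` {t (0, c), t (1, c)} \<inter> \<sigma> ` B"
      using C(1)[OF that(1)] by (intro image_Int permutes_inj)
    then show ?thesis unfolding pair_B[OF that(2)] C(2)[OF that] by simp
  qed
  have transversal: "X \<subseteq> \<Union>P \<and> (\<forall>p\<in>P. card (p \<inter> X) = 1)" if "\<sigma> \<in> C" "\<sigma> ` B = X" for \<sigma>
  proof
    have "\<sigma> (t (1, c)) \<in> {t (0, c), t (1, c)}" if "c < i" for c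
      using C(2)[OF \<open>\<sigma> \<in> C\<close> that] by blast
    then show "X \<subseteq> \<Union>P" unfolding that(2)[symmetric] B P_def by blast
    show "\<forall>p\<in>P. card (p \<inter> X) = 1"
      using pair_X[OF that(1)] that(2) by (auto simp: P_def)
  qed
  \<comment> \<open>By \<open>pair_X\<close> the image of the second row fixes the image of each
    lower entry. The upper entry of that column goes to the other element, and entries of columns of
    length 1 stay fixed.\<close>
  have unique: "\<sigma> = \<tau>" if "\<sigma> \<in> C" "\<tau> \<in> C" "\<sigma> ` B = \<tau> ` B" for \<sigma> \<tau>
  proof
    fix z
    show "\<sigma> z = \<tau> z"
    proof (cases "z \<in> {1..n}")
      case False
      then show ?thesis
        using C(1)[OF that(1)] C(1)[OF that(2)] by (simp add: permutes_not_in)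
    next
      case True
      then obtain d where d: "d \<in> ?D" "z = t d"
        using bij_betw_imp_surj_on[OF bij] by blast
      have 1: "\<sigma> (t (1, c)) = \<tau> (t (1, c))" if "c < i" for c
        using pair_X[OF \<open>\<sigma> \<in> C\<close> that] pair_X[OF \<open>\<tau> \<in> C\<close> that] \<open>\<sigma> ` B = \<tau> ` B\<close> by simp
      have 2: "\<sigma> (t (0, c)) = \<tau> (t (0, c))" if "c < i" for c
      proof -
        have "t (0, c) \<noteq> t (1, c)" using that i by (simp add: eq)
        then have "\<sigma> (t (0, c)) \<noteq> \<sigma> (t (1, c))" "\<tau> (t (0, c)) \<noteq> \<tau> (t (1, c))"
          using permutes_inj[OF C(1)[OF \<open>\<sigma> \<in> C\<close>]] permutes_inj[OF C(1)[OF \<open>\<tau> \<in> C\<close>]]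
          by (simp_all add: inj_eq)
        moreover have "{\<sigma> (t (0, c)), \<sigma> (t (1, c))} = {\<tau> (t (0, c)), \<tau> (t (1, c))}"
          using C(2)[OF \<open>\<sigma> \<in> C\<close> that] C(2)[OF \<open>\<tau> \<in> C\<close> that] by simp
        ultimately show ?thesis using 1[OF that] by (auto simp: doubleton_eq_iff)
      qed
      from d consider c where "c < i" "d = (1, c)" | c where "c < i" "d = (0, c)"
        | c where "i \<le> c" "c < n - i" "d = (0, c)"
        by fastforce
      then show ?thesis
      proof cases
        case 3
        then show ?thesis using C(3)[OF that(1)] C(3)[OF that(2)] d(2) by simp
      qed (use 1 2 d(2) in simp_all)
    qed
  qed
  have exists: "\<exists>\<sigma>\<in>C. \<sigma> ` B = X" if X: "X \<subseteq> \<Union>P" "\<forall>p\<in>P. card (p \<inter> X) = 1"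
  proof -
    \<comment> \<open>On cells, swap the columns of length 2 whose lower entry is not in
      \<open>X\<close>; the transversal \<open>X\<close> contains their upper entry instead.
      Transporting this involution along \<open>t\<close> gives the required column
      permutation.\<close>
    define \<tau> :: "nat \<times> nat \<Rightarrow> nat \<times> nat" where
      "\<tau> = (\<lambda>(r, c). if (r, c) \<in> ?D \<and> c < i \<and> t (1, c) \<notin> X then (1 - r, c) else (r, c))"
    have "\<tau> d \<in> ?D" if "d \<in> ?D" for d
      using that i by (cases d) (auto simp: \<tau>_def)
    moreover have "\<tau> (\<tau> d) = d" for d
      using i by (cases d) (auto simp: \<tau>_def)
    ultimately have "bij_betw \<tau> ?D ?D" by (intro bij_betw_byWitness[where f' = \<tau>]) blast+
    moreover have "\<tau> d = d" if "d \<notin> ?D" for d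
      using that by (cases d) (auto simp: \<tau>_def)
    ultimately have "\<tau> permutes ?D" by (intro bij_imp_permutes) auto
    define \<sigma> where "\<sigma> = (\<lambda>x. if x \<in> {1..n} then t (\<tau> (inv_into ?D t x)) else x)"
    have p: "\<sigma> permutes {1..n}"
      unfolding \<sigma>_def using \<open>\<tau> permutes ?D\<close> bij by (rule permutes_bij_inv_into)
    have \<sigma>t: "\<sigma> (t d) = t (\<tau> d)" if "d \<in> ?D" for d
    proof -
      have "t d \<in> {1..n}" using bij_betwE[OF bij] that by blast
      then show ?thesis unfolding \<sigma>_def bij_betw_inv_into_left[OF bij that] by (rule if_P)
    qed
    have \<sigma>_pair: "\<sigma> (t (0, c)) = (if t (1, c) \<in> X then t (0, c) else t (1, c))"
      "\<sigma> (t (1, c)) = (if t (1, c) \<in> X then t (1, c) else t (0, c))" if "c < i" for c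
    proof -
      have "c < n - i" using that i by simp
      then show "\<sigma> (t (0, c)) = (if t (1, c) \<in> X then t (0, c) else t (1, c))"
        "\<sigma> (t (1, c)) = (if t (1, c) \<in> X then t (1, c) else t (0, c))"
        using that by (simp_all add: \<sigma>t \<tau>_def)
    qed
    have "\<sigma> ` col_entries (two_row n i) t c = col_entries (two_row n i) t c" for c
    proof (cases "c < i")
      case True
      then show ?thesis using \<sigma>_pair[OF True] by (auto simp: col_entries_two_row[OF i])
    next
      case False
      then show ?thesis by (simp add: col_entries_two_row[OF i] \<sigma>t \<tau>_def)
    qed
    then have "\<sigma> \<in> C" using p \<open>i \<le> n\<close> by (simp add: C_def col_stab_def sum_list_two_row)
    moreover have "\<sigma> ` B = X"
    proof -
      have cX: "{t (0, c), t (1, c)} \<inter> X = {\<sigma> (t (1, c))}" if "c < i" for c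
      proof -
        have "card ({t (0, c), t (1, c)} \<inter> X) = 1" using X(2) that unfolding P_def by blast
        then obtain x where x: "{t (0, c), t (1, c)} \<inter> X = {x}" by (rule card_1_singletonE)
        have "\<sigma> (t (1, c)) = x"
        proof (cases "t (1, c) \<in> X")
          case True
          then have "t (1, c) \<in> {x}" unfolding x[symmetric] by simp
          then show ?thesis using \<sigma>_pair(2)[OF that] True by simp
        next
          case False
          have "x \<in> {t (0, c), t (1, c)} \<inter> X" unfolding x by simp
          then show ?thesis using \<sigma>_pair(2)[OF that] False by auto
        qed
        then show ?thesis using x by simp
      qed
      have "X = (\<Union>c<i. {t (0, c), t (1, c)} \<inter> X)" using X(1) by (auto simp: P_def)
      also have "\<dots> = (\<Union>c<i. {\<sigma> (t (1, c))})" using cX by simp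
      also have "\<dots> = \<sigma> ` B" by (auto simp: B)
      finally show ?thesis ..
    qed
    ultimately show ?thesis by blast
  qed
  show ?thesis
  proof (cases "X \<subseteq> \<Union>P \<and> (\<forall>p\<in>P. card (p \<inter> X) = 1)")
    case True
    then obtain \<sigma> where "\<sigma> \<in> C" "\<sigma> ` B = X" using exists by blast
    then have "{\<sigma>\<in>C. \<sigma> ` B = X} = {\<sigma>}" using unique by blast
    then show ?thesis using True by (simp add: transv_def)
  next
    case False
    then have "{\<sigma>\<in>C. \<sigma> ` B = X} = {}" using transversal by blast
    then show ?thesis using False unfolding transv_def by (simp only: card.empty of_nat_0 if_False)
  qed
qed

section \<open>Polytabloids as products over matchings\<close>

lemma tabloid_act_tabloids:
  assumes T: "T \<in> tabloids lam" and \<sigma>: "\<sigma> permutes {1..sum_list lam}"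
  shows "tabloid_act \<sigma> T \<in> tabloids lam"
    and "tabloid_row lam (tabloid_act \<sigma> T) r = \<sigma> ` tabloid_row lam T r"
proof -
  obtain t where t: "t \<in> tableaux lam" "T = tabloid_of lam t"
    using T by (auto simp: tabloids_def)
  note a = tabloid_act_tabloid_of[OF t(1) \<sigma>]
  show "tabloid_act \<sigma> T \<in> tabloids lam"
    unfolding t(2) a(1) tabloids_def using a(2) by (rule imageI)
  show "tabloid_row lam (tabloid_act \<sigma> T) r = \<sigma> ` tabloid_row lam T r"
    unfolding t(2) a(1) tabloid_row_tabloid_of[OF t(1)] tabloid_row_tabloid_of[OF a(2)]
    by (auto simp: row_entries_def)
qed

text \<open>All signs are 1 in characteristic 2, so the coefficient at \<open>T\<close> counts the
  column permutations that carry the second row of \<open>t\<close> to that of \<open>T\<close>. The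
  count is \<open>card_col_stab_row_image\<close>.\<close>

lemma polytabloid_two_row:
  assumes c: "CHAR('a::field) = 2" and t: "t \<in> tableaux (two_row n i)" and i: "2 * i \<le> n"
  shows "polytabloid (two_row n i) t
    = (tabloid_vec n i (transv ((\<lambda>c. {t (0, c), t (1, c)}) ` {..<i})) :: tabloid \<Rightarrow> 'a)"
proof
  fix T
  let ?lam = "two_row n i"
  let ?C = "col_stab ?lam t" and ?B = "row_entries ?lam t 1"
  have "i \<le> n" using i by simp
  have p: "\<sigma> permutes {1..sum_list ?lam}" if "\<sigma> \<in> ?C" for \<sigma>
    using that by (simp add: col_stab_def)
  have fC: "finite ?C"
    using finite_permutations[of "{1..sum_list ?lam}"] p by (auto intro: rev_finite_subset)
  have act: "tabloid_act \<sigma> (tabloid_of ?lam t) \<in> tabloids ?lam"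
    "tabloid_row ?lam (tabloid_act \<sigma> (tabloid_of ?lam t)) 1 = \<sigma> ` ?B" if "\<sigma> \<in> ?C" for \<sigma>
    using tabloid_act_tabloids[OF _ p[OF that], of "tabloid_of ?lam t"] t
    by (simp_all add: tabloids_def tabloid_row_tabloid_of)
  have "polytabloid ?lam t T
      = (\<Sum>\<sigma>\<in>?C. if T = tabloid_act \<sigma> (tabloid_of ?lam t) then 1 else (0::'a))"
    unfolding polytabloid_def
    by (subst sum_fun_apply) (simp add: scl_def basis_vec_def char2_of_int_sign[OF c])
  also have "\<dots> = of_nat (card {\<sigma>\<in>?C. T = tabloid_act \<sigma> (tabloid_of ?lam t)})"
    using fC by (simp add: sum.If_cases Int_def)
  also have "\<dots> = tabloid_vec n i (transv ((\<lambda>c. {t (0, c), t (1, c)}) ` {..<i})) T"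
  proof (cases "T \<in> tabloids ?lam")
    case True
    have "T = tabloid_act \<sigma> (tabloid_of ?lam t) \<longleftrightarrow> \<sigma> ` ?B = tabloid_row ?lam T 1"
      if "\<sigma> \<in> ?C" for \<sigma>
      using inj_onD[OF bij_betw_imp_inj_on[OF bij_betw_tabloid_row[OF \<open>i \<le> n\<close>]] _ True act(1)[OF that]]
        act(2)[OF that] by metis
    then have "{\<sigma>\<in>?C. T = tabloid_act \<sigma> (tabloid_of ?lam t)}
        = {\<sigma>\<in>?C. \<sigma> ` ?B = tabloid_row ?lam T 1}" by blast
    then show ?thesis
      using True card_col_stab_row_image[OF t i] by (simp add: tabloid_vec_def)
  next
    case False
    then have e: "{\<sigma>\<in>?C. T = tabloid_act \<sigma> (tabloid_of ?lam t)} = {}" using act(1) by blast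
    show ?thesis unfolding e using False by (simp add: tabloid_vec_def)
  qed
  finally show "polytabloid ?lam t T
    = (tabloid_vec n i (transv ((\<lambda>c. {t (0, c), t (1, c)}) ` {..<i})) T :: 'a)" .
qed

lemma two_row_tableau_matching:
  assumes t: "t \<in> tableaux (two_row n i)" and i: "2 * i \<le> n"
  shows "(\<lambda>c. {t (0, c), t (1, c)}) ` {..<i} \<in> matchings {1..n} i"
proof -
  let ?D = "{0} \<times> {..<n - i} \<union> {1} \<times> {..<i} :: (nat \<times> nat) set"
  have bij: "bij_betw t ?D {1..n}" using bij_betw_two_row_tableau[OF t] i by simp
  have eq: "t d = t e \<longleftrightarrow> d = e" if "d \<in> ?D" "e \<in> ?D" for d e
    using bij that by (auto simp: bij_betw_def inj_on_eq_iff)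
  have "{t (0, c), t (1, c)} \<subseteq> {1..n}" if "c < i" for c
    using bij_betwE[OF bij] that i by simp
  moreover have "pairwise disjnt ((\<lambda>c. {t (0, c), t (1, c)}) ` {..<i})"
    using i by (intro pairwise_imageI) (auto simp: disjnt_iff eq)
  moreover have "card {t (0, c), t (1, c)} = 2" if "c < i" for c
    using that i by (simp add: eq)
  moreover have "inj_on (\<lambda>c. {t (0, c), t (1, c)}) {..<i}"
    using i by (intro inj_onI) (auto simp: doubleton_eq_iff eq)
  then have "card ((\<lambda>c. {t (0, c), t (1, c)}) ` {..<i}) = i" by (simp add: card_image)
  ultimately show ?thesis by (auto simp: matchings_def)
qed

text \<open>Every matching arises from a tableau, so the span over matchings is no larger than the
  Specht module.\<close>

lemma matching_two_row_tableau:
  assumes P: "P \<in> matchings {1..n} i" and i: "2 * i \<le> n"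
  shows "\<exists>t\<in>tableaux (two_row n i). (\<lambda>c. {t (0, c), t (1, c)}) ` {..<i} = P"
proof -
  have fP: "finite P" using matchings_finite[OF P] by simp
  have sub: "\<Union>P \<subseteq> {1..n}" and card2: "\<And>p. p \<in> P \<Longrightarrow> card p = 2" and cP: "card P = i"
    using P by (auto simp: matchings_def)
  obtain p where p: "p ` {..<i} = P"
    using ex_bij_betw_nat_finite[OF fP] cP by (auto simp: atLeast0LessThan bij_betw_def)
  have "\<forall>c\<in>{..<i}. \<exists>x y. p c = {x, y}"
    using card2 p by (metis card_2_iff imageI)
  then obtain a b where ab: "\<And>c. c < i \<Longrightarrow> p c = {a c, b c}"
    by (metis lessThan_iff)
  have "card ({1..n} - \<Union>P) = n - 2 * i"
    using card_Union_matching[OF P] sub finite_subset[OF sub] by (simp add: card_Diff_subset)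
  then obtain h where h: "h ` {..<n - 2 * i} = {1..n} - \<Union>P"
    using ex_bij_betw_nat_finite[of "{1..n} - \<Union>P"] by (auto simp: atLeast0LessThan bij_betw_def)
  \<comment> \<open>The pairs of \<open>P\<close> form the first \<open>i\<close> columns. The
    unmatched points, listed by \<open>h\<close>, fill row 0 from column \<open>i\<close> on, hence
    the shift \<open>c - i\<close>.\<close>
  define t :: tableau where
    "t = (\<lambda>(r, c). if r = 1 then b c else if c < i then a c else h (c - i))"
  have "{..<n - i} = {..<i} \<union> (\<lambda>c. c + i) ` {..<n - 2 * i}"
  proof (intro equalityI subsetI)
    fix c assume "c \<in> {..<n - i}"
    then have "c < i \<or> c = (c - i) + i \<and> c - i < n - 2 * i" by auto
    then show "c \<in> {..<i} \<union> (\<lambda>c. c + i) ` {..<n - 2 * i}" by blast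
  qed (use i in auto)
  then have "(\<lambda>c. t (0, c)) ` {..<n - i}
      = (\<lambda>c. t (0, c)) ` {..<i} \<union> (\<lambda>c. t (0, c + i)) ` {..<n - 2 * i}"
    by (simp only: image_Un image_image)
  moreover have "(\<lambda>c. t (0, c)) ` {..<i} = a ` {..<i}"
    by (intro image_cong) (simp_all add: t_def)
  moreover have "(\<lambda>c. t (0, c + i)) ` {..<n - 2 * i} = h ` {..<n - 2 * i}"
    by (simp add: t_def)
  moreover have "(\<lambda>c. t (1, c)) ` {..<i} = b ` {..<i}" by (simp add: t_def)
  moreover have "t ` ({0} \<times> {..<n - i} \<union> {1} \<times> {..<i})
      = (\<lambda>c. t (0, c)) ` {..<n - i} \<union> (\<lambda>c. t (1, c)) ` {..<i}" by auto
  moreover have "\<Union>P = a ` {..<i} \<union> b ` {..<i}"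
    unfolding p[symmetric] using ab by auto
  ultimately have "t ` ({0} \<times> {..<n - i} \<union> {1} \<times> {..<i}) = {1..n}"
    using h sub by auto
  then have "t \<in> tableaux (two_row n i)" using i by (intro two_row_tableauI) auto
  moreover have "(\<lambda>c. {t (0, c), t (1, c)}) ` {..<i} = P"
    unfolding p[symmetric] using ab by (intro image_cong) (simp_all add: t_def)
  ultimately show ?thesis by blast
qed

lemma tabloid_vec_add: "tabloid_vec n i (f + g) = tabloid_vec n i f + tabloid_vec n i g"
  by (simp add: tabloid_vec_def fun_eq_iff)

lemma tabloid_vec_scl: "tabloid_vec n i (set_scl a f) = scl a (tabloid_vec n i f)"
  by (simp add: tabloid_vec_def scl_def set_scl_def fun_eq_iff)

text \<open>The generators correspond under the linear map \<open>tabloid_vec n i\<close>, which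
  sends a span to the span of the images.\<close>

lemma specht_two_row:
  assumes c: "CHAR('a::field) = 2" and i: "2 * i \<le> n"
  shows "specht (two_row n i) = (tabloid_vec n i ` matching_span {1..n} i :: (tabloid \<Rightarrow> 'a) set)"
proof -
  let ?P = "\<lambda>t :: tableau. (\<lambda>c. {t (0, c), t (1, c)}) ` {..<i}"
  have "?P ` tableaux (two_row n i) = matchings {1..n} i"
    using two_row_tableau_matching[OF _ i] matching_two_row_tableau[OF _ i] by blast
  moreover have "(polytabloid (two_row n i) :: tableau \<Rightarrow> tabloid \<Rightarrow> 'a) ` tableaux (two_row n i)
      = (\<lambda>t. tabloid_vec n i (transv (?P t))) ` tableaux (two_row n i)"
    by (intro image_cong refl polytabloid_two_row[OF c _ i])
  ultimately have "(polytabloid (two_row n i) :: tableau \<Rightarrow> tabloid \<Rightarrow> 'a) ` tableaux (two_row n i)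
      = tabloid_vec n i ` transv ` matchings {1..n} i"
    by (metis image_image)
  moreover have "module_hom set_scl scl (tabloid_vec n i :: _ \<Rightarrow> tabloid \<Rightarrow> 'a)"
    unfolding module_hom_iff
    by (intro conjI allI setvec.module_axioms tabvec.module_axioms tabloid_vec_add tabloid_vec_scl)
  ultimately show ?thesis
    unfolding specht_def matching_span_def by (simp only: module_hom.span_image)
qed

lemma perm_act_tabloid_vec:
  assumes \<sigma>: "\<sigma> permutes {1..n}" and i: "i \<le> n"
  shows "perm_act \<sigma> (tabloid_vec n i f) = tabloid_vec n i (\<lambda>X. f (inv \<sigma> ` X))"
proof
  fix T
  let ?lam = "two_row n i"
  have \<sigma>': "\<sigma> permutes {1..sum_list ?lam}" using \<sigma> i by (simp add: sum_list_two_row)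
  note inv\<sigma> = permutes_inv[OF \<sigma>']
  have "tabloid_act \<sigma> (tabloid_act (inv \<sigma>) T) = T"
    using permutes_inv_o(1)[OF \<sigma>] by (simp add: tabloid_act_def image_image comp_assoc[symmetric])
  then have "tabloid_act (inv \<sigma>) T \<in> tabloids ?lam \<longleftrightarrow> T \<in> tabloids ?lam"
    using tabloid_act_tabloids(1)[OF _ \<sigma>'] tabloid_act_tabloids(1)[OF _ inv\<sigma>] by metis
  then show "perm_act \<sigma> (tabloid_vec n i f) T = tabloid_vec n i (\<lambda>X. f (inv \<sigma> ` X)) T"
    using tabloid_act_tabloids(2)[OF _ inv\<sigma>] by (simp add: perm_act_def tabloid_vec_def)
qed

section \<open>Exactness\<close>

text \<open>The image lies in the kernel because raising twice gives zero; conversely, the homotopy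
  gives \<open>f = raise A (lower 1 f)\<close> in the relevant degree when \<open>raise A f\<close>
  vanishes in the next. The guard \<open>Suc i < k\<close> accounts for the last map being zero: for
  \<open>Suc i = k\<close> the claim is surjectivity.\<close>

lemma theta_image_eq_kernel:
  assumes c: "CHAR('a::field) = 2" and i: "Suc i \<le> k"
  shows "theta (2 * k) i ` specht (two_row (2 * k) i)
    = {v \<in> specht (two_row (2 * k) (Suc i)).
        Suc i < k \<longrightarrow> theta (2 * k) (Suc i) v = (0 :: tabloid \<Rightarrow> 'a)}"
proof -
  let ?n = "2 * k"
  let ?A = "{1..?n}"
  let ?M = "matching_span ?A :: nat \<Rightarrow> (nat set \<Rightarrow> 'a) set"
  have A: "finite ?A" "even (card ?A)" "1 \<in> ?A" using i by auto
  have sp: "specht (two_row ?n i) = tabloid_vec ?n i ` ?M i"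
    "specht (two_row ?n (Suc i)) = tabloid_vec ?n (Suc i) ` ?M (Suc i)"
    using specht_two_row[OF c] i by simp_all
  have th: "theta ?n i (tabloid_vec ?n i g) = tabloid_vec ?n (Suc i) (raise ?A g)"
    for g :: "nat set \<Rightarrow> 'a"
    using i by (simp add: theta_tabloid_vec)
  show ?thesis
    unfolding sp
  proof (intro equalityI subsetI)
    fix v assume "v \<in> theta ?n i ` tabloid_vec ?n i ` ?M i"
    then obtain g where g: "g \<in> ?M i" and v: "v = tabloid_vec ?n (Suc i) (raise ?A g)"
      using th by auto
    have "theta ?n (Suc i) v = 0" if "Suc i < k"
    proof -
      have "Suc i < ?n" using that by simp
      then show ?thesis
        unfolding v theta_tabloid_vec[OF \<open>Suc i < ?n\<close>] raise_raise[OF c A(1)]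
        by (intro tabloid_vec_0)
    qed
    then show "v \<in> {v \<in> tabloid_vec ?n (Suc i) ` ?M (Suc i). Suc i < k \<longrightarrow> theta ?n (Suc i) v = 0}"
      using raise_matching_span[OF c A(1,2) g] v by blast
  next
    fix v assume "v \<in> {v \<in> tabloid_vec ?n (Suc i) ` ?M (Suc i). Suc i < k \<longrightarrow> theta ?n (Suc i) v = 0}"
    then obtain f where f: "f \<in> ?M (Suc i)" and v: "v = tabloid_vec ?n (Suc i) f"
      and 0: "Suc i < k \<Longrightarrow> theta ?n (Suc i) (tabloid_vec ?n (Suc i) f) = 0"
      by blast
    \<comment> \<open>Below the top degree this is the kernel hypothesis, which only sees subsets of
      size \<open>i + 2\<close>. In the top degree it holds for every element of the span.\<close>
    have r0: "raise ?A f X = 0" if X: "X \<subseteq> ?A" "card X = Suc (Suc i)" for X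
    proof (cases "Suc i < k")
      case True
      then have "tabloid_vec ?n (Suc (Suc i)) (raise ?A f) = 0"
        using 0 by (simp add: theta_tabloid_vec)
      then show ?thesis using True by (intro tabloid_vec_eq_0[OF _ _ X]) auto
    next
      case False
      then have "raise ?A f = 0"
        using raise_matching_span_top[OF c A(1), of k f] f i by (simp add: le_less)
      then show ?thesis by simp
    qed
    \<comment> \<open>The other summand of \<open>raise_lower\<close> is zero by definition if
      \<open>X\<close> contains 1, and otherwise is the value of \<open>raise\<close> at
      \<open>insert 1 X\<close>, covered by \<open>r0\<close>.\<close>
    have "f X = raise ?A (lower 1 f) X" if "X \<subseteq> ?A" "card X = Suc i" for X
    proof -
      have "lower 1 (raise ?A f) X = 0"
        using that r0[of "insert 1 X"] A(3) finite_subset[OF that(1)] by (simp add: lower_def)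
      then show ?thesis using fun_cong[OF raise_lower[OF c A(1,3), of f], of X] by simp
    qed
    then have "v = theta ?n i (tabloid_vec ?n i (lower 1 f))"
      unfolding v th using i by (intro tabloid_vec_cong) auto
    then show "v \<in> theta ?n i ` tabloid_vec ?n i ` ?M i"
      using lower_matching_span[OF A(1) f] by blast
  qed
qed

text \<open>In degree 0 the homotopy loses a term: \<open>raise\<close> is an empty sum at the empty
  set. What remains is that \<open>f\<close> at the empty set equals \<open>raise\<close> of
  \<open>f\<close> at \<open>{1}\<close>.\<close>

lemma theta_kernel_0:
  assumes c: "CHAR('a::field) = 2" and k: "0 < k"
  shows "{v \<in> specht (two_row (2 * k) 0). theta (2 * k) 0 v = 0} = {0 :: tabloid \<Rightarrow> 'a}"
proof -
  let ?n = "2 * k"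
  let ?A = "{1..?n}"
  have A: "finite ?A" "1 \<in> ?A" using k by auto
  have sp: "specht (two_row ?n 0) = (tabloid_vec ?n 0 ` matching_span ?A 0 :: (tabloid \<Rightarrow> 'a) set)"
    using specht_two_row[OF c, of 0 ?n] by simp
  have "v = 0" if v: "v \<in> specht (two_row ?n 0)" and 0: "theta ?n 0 v = 0" for v :: "tabloid \<Rightarrow> 'a"
  proof -
    obtain f where f: "f \<in> matching_span ?A 0" "v = tabloid_vec ?n 0 f" using v sp by auto
    have r0: "tabloid_vec ?n (Suc 0) (raise ?A f) = 0"
      using 0 f(2) k by (simp add: theta_tabloid_vec)
    have "f X = 0" if "X \<subseteq> ?A" "card X = 0" for X
    proof -
      have "X = {}" using that finite_subset by fastforce
      have "lower 1 (raise ?A f) {} = 0"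
        using tabloid_vec_eq_0[OF _ r0, of "{1}"] A(2) k by (simp add: lower_def)
      moreover have "raise ?A (lower 1 f) {} = 0" by (simp add: raise_def)
      ultimately show ?thesis
        using fun_cong[OF raise_lower[OF c A, of f], of "{}"] \<open>X = {}\<close> by simp
    qed
    then have "v = tabloid_vec ?n 0 0"
      unfolding f(2) by (intro tabloid_vec_cong) auto
    then show ?thesis by (simp add: tabloid_vec_0)
  qed
  moreover have "theta ?n 0 0 = (0 :: tabloid \<Rightarrow> 'a)"
    by (simp add: theta_def fun_eq_iff sum_fun_apply scl_def)
  moreover have "0 \<in> specht (two_row ?n 0)" unfolding specht_def by (rule tabvec.span_zero)
  ultimately show ?thesis by blast
qed

section \<open>Module structure, homomorphisms and the assembled sequence\<close>

lemma sym_module_specht_two_row: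
  assumes c: "CHAR('a::field) = 2" and i: "2 * i \<le> n"
  shows "sym_module n (specht (two_row n i) :: (tabloid \<Rightarrow> 'a) set)"
  unfolding sym_module_def
proof (intro conjI allI impI ballI)
  show "tabvec.subspace (specht (two_row n i) :: (tabloid \<Rightarrow> 'a) set)"
    unfolding specht_def by (rule tabvec.subspace_span)
  fix \<sigma> and v :: "tabloid \<Rightarrow> 'a"
  assume \<sigma>: "\<sigma> permutes {1..n}" and v: "v \<in> specht (two_row n i)"
  obtain f where f: "f \<in> matching_span {1..n} i" "v = tabloid_vec n i f"
    using v specht_two_row[OF c i] by auto
  show "perm_act \<sigma> v \<in> specht (two_row n i)"
    unfolding f(2) specht_two_row[OF c i] using image_matching_span[OF \<sigma> f(1)] i
    by (simp add: perm_act_tabloid_vec[OF \<sigma>])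
qed

text \<open>Landing in the next Specht module is part of \<open>theta_image_eq_kernel\<close>;
  equivariance is the invariance of the sum of the variables, \<open>raise_image\<close>.\<close>

lemma sym_hom_theta:
  assumes c: "CHAR('a::field) = 2" and i: "i < k"
  shows "sym_hom (2 * k) (specht (two_row (2 * k) i) :: (tabloid \<Rightarrow> 'a) set)
    (specht (two_row (2 * k) (Suc i))) (theta (2 * k) i)"
  unfolding sym_hom_def
proof (intro conjI allI impI ballI)
  let ?n = "2 * k"
  fix u v :: "tabloid \<Rightarrow> 'a" and a
  assume v: "v \<in> specht (two_row ?n i)"
  show "theta ?n i v \<in> specht (two_row ?n (Suc i))"
    using theta_image_eq_kernel[OF c, of i k] i v by auto
  show "theta ?n i (u + v) = theta ?n i u + theta ?n i v"
    by (simp add: theta_def scl_def fun_eq_iff sum_fun_apply distrib_right sum.distrib)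
  show "theta ?n i (scl a v) = scl a (theta ?n i v)"
    by (simp add: theta_def scl_def fun_eq_iff sum_fun_apply sum_distrib_left mult.assoc)
  fix \<sigma> assume \<sigma>: "\<sigma> permutes {1..?n}"
  obtain f where f: "v = tabloid_vec ?n i f"
    using v specht_two_row[OF c, of i ?n] i by auto
  show "theta ?n i (perm_act \<sigma> v) = perm_act \<sigma> (theta ?n i v)"
  proof -
    have l: "i \<le> ?n" "Suc i \<le> ?n" "i < ?n" using i by simp_all
    show ?thesis
      unfolding f perm_act_tabloid_vec[OF \<sigma> l(1)] theta_tabloid_vec[OF l(3)]
        perm_act_tabloid_vec[OF \<sigma> l(2)] raise_image[OF \<sigma>] ..
  qed
qed

theorem proposition4p5:
  fixes n k :: nat
  assumes "CHAR('a::field) = 2"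
    and "n = 2 * k" and "n > 0"
  shows "sym_exact n (- 1) (int k + 1)
    (two_row_specht n k :: int \<Rightarrow> (tabloid \<Rightarrow> 'a) set) (theta_hat n k)"
proof -
  have k: "0 < k" using assms by simp
  let ?V = "two_row_specht n k :: int \<Rightarrow> (tabloid \<Rightarrow> 'a) set"
  have V: "?V (int i) = specht (two_row n i)" if "i \<le> k" for i
    using that by (simp add: two_row_specht_def)
  have V0: "?V i = {0}" if "\<not> (0 \<le> i \<and> i \<le> int k)" for i
    unfolding two_row_specht_def using that by (rule if_not_P)
  have mod0: "sym_module n {0 :: tabloid \<Rightarrow> 'a}"
    by (auto simp: sym_module_def perm_act_def fun_eq_iff)
  have zero: "0 \<in> ?V i" for i
    by (simp add: two_row_specht_def specht_def tabvec.span_zero)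
  have mod: "sym_module n (?V i)" for i
  proof (cases "0 \<le> i \<and> i \<le> int k")
    case True
    then obtain j where "i = int j" "j \<le> k" by (metis nonneg_int_cases of_nat_le_iff)
    then show ?thesis using V sym_module_specht_two_row[OF assms(1)] assms(2) by simp
  qed (simp add: V0 mod0)
  have hom: "sym_hom n (?V i) (?V (i + 1)) (theta_hat n k i)" for i
  proof (cases "0 \<le> i \<and> i < int k")
    case True
    then obtain j where j: "i = int j" "j < k" by (metis nonneg_int_cases of_nat_less_iff)
    have "?V (i + 1) = specht (two_row n (Suc j))" using V[of "Suc j"] j by (simp add: add.commute)
    then show ?thesis
      using V[of j] j sym_hom_theta[OF assms(1) j(2)] assms(2) by (simp add: theta_hat_def)
  next
    case False
    then have t: "theta_hat n k i = (\<lambda>v :: tabloid \<Rightarrow> 'a. 0)" by (auto simp: theta_hat_def)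
    show ?thesis
      unfolding sym_hom_def t using zero by (auto simp: scl_def perm_act_def fun_eq_iff)
  qed
  \<comment> \<open>The interior degrees between \<open>- 1\<close> and \<open>int k + 1\<close> are
    \<open>0\<close> to \<open>int k\<close>. In degree 0 the incoming image is zero, so the claim
    is injectivity; for \<open>i = Suc j\<close> the incoming map is \<open>theta n j\<close>, and
    at \<open>i = int k\<close> the zero map matches the failing guard.\<close>
  have exact: "theta_hat n k (i - 1) ` ?V (i - 1) = {v \<in> ?V i. theta_hat n k i v = 0}"
    if i: "0 \<le> i" "i \<le> int k" for i
  proof (cases "i = 0")
    case True
    then show ?thesis
      using V[of 0] V0[of "- 1"] k theta_kernel_0[OF assms(1) k] assms(2)
      by (simp add: theta_hat_def)
  next
    case False
    then obtain j where j: "i = int (Suc j)" "Suc j \<le> k"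
      using i by (metis nonneg_int_cases not0_implies_Suc of_nat_0 of_nat_le_iff)
    have "theta_hat n k (i - 1) ` ?V (i - 1) = theta n j ` specht (two_row n j)"
      using V[of j] j by (simp add: theta_hat_def)
    moreover have "{v \<in> ?V i. theta_hat n k i v = 0}
        = {v \<in> specht (two_row n (Suc j)). Suc j < k \<longrightarrow> theta n (Suc j) v = 0}"
      using V[of "Suc j"] j by (auto simp: theta_hat_def nat_add_distrib)
    ultimately show ?thesis
      using theta_image_eq_kernel[OF assms(1) j(2)] assms(2) by simp
  qed
  show ?thesis
    unfolding sym_exact_def using mod hom exact by auto
qed

end
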